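(* Let $0<q<p$, $0<x<1/p$, and $k=q/p$. Let $\varphi\in(0,\pi/2)$ be the amplitude defined by $\sin\varphi=px$. Lagrange's arithmetic-geometric-mean transformation, applied to the first kind elliptic integral of modulus $k$ and amplitude $\varphi$, changes its parameters $k,\varphi$ and defines a new amplitude $\hat\varphi\in(0,\pi/2)$, given by $$\sin\hat\varphi=\sqrt{\frac{1+pqx^{2}-\sqrt{(1-p^{2}x^{2})(1-q^{2}x^{2})}}{2}},$$ such that $$\tan\varphi=\frac{\sin(2\hat\varphi)}{k+\cos(2\hat\varphi)} .$$
   Context: The first kind elliptic integral of modulus $k$ and amplitude $\varphi$ is $F(k,\varphi)=\int_0^{\varphi}\frac{d\theta}{\sqrt{1-k^2\sin^2\theta}}=\int_0^{\sin\varphi}\frac{dz}{\sqrt{(1-z^2)(1-k^2z^2)}}$. Lagrange's AGM transformation: for $0<q<p$ put $p_1=\frac{p+q}{2}$, $q_1=\sqrt{pq}$, and in the integral $\int_0^{x}\frac{dy}{\sqrt{(1-p^2y^2)(1-q^2y^2)}}$ substitute $$y=y_1\sqrt{\frac{1-p_1^2y_1^2}{1-q_1^2y_1^2}} .$$ The integral then becomes $\int_0^{s(x,p,q)}\frac{dy_1}{\sqrt{(1-p_1^2y_1^2)(1-q_1^2y_1^2)}}$ with upper limit $$s(x,p,q)=\frac{\sqrt2}{p+q}\sqrt{1+pqx^2-\sqrt{(1-p^2x^2)(1-q^2x^2)}} .$$ After the rescalings $z=py$, $z_1=p_1y_1$, the old integral has modulus $k=q/p$ and amplitude $\varphi$ with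 $\sin\varphi=px$; the new one has modulus $\hat k=q_1/p_1=\frac{2\sqrt k}{1+k}$ and amplitude $\hat\varphi$ with $\sin\hat\varphi=p_1\,s(x,p,q)$. *)

theory Defs
  imports "HOL-Analysis.Analysis"
begin

text \<open>The first argument is the modulus \<open>k\<close>, not the parameter \<open>m = k\<^sup>2\<close>.\<close>

definition elliptic_F :: "real \<Rightarrow> real \<Rightarrow> real" where
  "elliptic_F k \<phi> = integral {0..\<phi>} (\<lambda>\<theta>. 1 / sqrt (1 - k\<^sup>2 * (sin \<theta>)\<^sup>2))"

definition elliptic_pq :: "real \<Rightarrow> real \<Rightarrow> real \<Rightarrow> real" where
  "elliptic_pq p q x =
     integral {0..x} (\<lambda>y. 1 / sqrt ((1 - p\<^sup>2 * y\<^sup>2) * (1 - q\<^sup>2 * y\<^sup>2)))"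

definition amean :: "real \<Rightarrow> real \<Rightarrow> real" where
  "amean p q = (p + q) / 2"

definition gmean :: "real \<Rightarrow> real \<Rightarrow> real" where
  "gmean p q = sqrt (p * q)"

text \<open>Lagrange's substitution: the old variable \<open>y\<close> as a function of the new variable \<open>y\<^sub>1\<close>.\<close>

definition lagrange_subst :: "real \<Rightarrow> real \<Rightarrow> real \<Rightarrow> real" where
  "lagrange_subst p q y\<^sub>1 =
     y\<^sub>1 * sqrt ((1 - (amean p q)\<^sup>2 * y\<^sub>1\<^sup>2) / (1 - (gmean p q)\<^sup>2 * y\<^sub>1\<^sup>2))"

text \<open>The upper limit of the transformed integral, that is, the value of \<open>y\<^sub>1\<close> at \<open>y = x\<close>.\<close>

definition lagrange_limit :: "real \<Rightarrow> real \<Rightarrow> real \<Rightarrow> real" where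
  "lagrange_limit x p q =
     sqrt 2 / (p + q) *
       sqrt (1 + p * q * x\<^sup>2 - sqrt ((1 - p\<^sup>2 * x\<^sup>2) * (1 - q\<^sup>2 * x\<^sup>2)))"

end

theory Submission
  imports Defs
begin

text \<open>
  Write \<open>a\<close>, \<open>g\<close> for the two means and \<open>t = y\<^sub>1\<^sup>2\<close>. Under Lagrange's substitution
  both factors of the old radicand become squares over the same denominator,
  \<open>1 - p\<^sup>2y\<^sup>2 = (1 - apt)\<^sup>2 / (1 - g\<^sup>2t)\<close> and \<open>1 - q\<^sup>2y\<^sup>2 = (1 - aqt)\<^sup>2 / (1 - g\<^sup>2t)\<close>,
  while \<open>(1 - apt)(1 - aqt)\<close> is also the numerator of \<open>dy/dy\<^sub>1\<close>; it is positive up to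
  \<open>t = 1/(ap)\<close>, which the new upper limit does not reach.
  For the amplitudes, put \<open>sin \<beta> = qx\<close>. Then the formula for \<open>sin \<phi>h\<close> says
  \<open>cos (2\<phi>h) = cos (\<phi> + \<beta>)\<close>, so \<open>2\<phi>h = \<phi> + \<beta>\<close>, and \<open>k = sin \<beta> / sin \<phi>\<close> gives
  \<open>k + cos (\<phi> + \<beta>) = cot \<phi> sin (\<phi> + \<beta>)\<close>.
\<close>

section \<open>Legendre form of the algebraic integral\<close>

text \<open>Substituting y = sin theta / p turns 1 - p^2 y^2 into cos^2 theta, whose root cancels
  against the derivative cos theta / p. Applied both to the pair p, q and to the pair of
  means.\<close>

lemma elliptic_pq_eq_elliptic_F:
  fixes p q x \<phi> :: real
  assumes "0 < q" "q < p" "0 \<le> \<phi>" "\<phi> < pi / 2" "sin \<phi> = p * x"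
  shows "elliptic_pq p q x = elliptic_F (q / p) \<phi> / p"
proof -
  let ?f = "\<lambda>y. 1 / sqrt ((1 - p\<^sup>2 * y\<^sup>2) * (1 - q\<^sup>2 * y\<^sup>2))"
  let ?s = "\<lambda>\<theta>. sin \<theta> / p"
  have p: "0 < p" using assms by simp
  have x: "x = sin \<phi> / p" using assms p by simp
  \<comment> \<open>This keeps the singularity y = 1/p of the integrand out of
    \<open>{0..x}\<close>.\<close>
  have sin_lt: "sin \<phi> < 1"
    using sin_monotone_2pi[of \<phi> "pi/2"] assms by simp
  have x0: "0 \<le> x" unfolding x using p assms by (intro divide_nonneg_pos sin_ge_zero) auto
  have cont: "continuous_on {0..x} ?f"
  proof -
    have pos: "0 < (1 - p\<^sup>2 * y\<^sup>2) * (1 - q\<^sup>2 * y\<^sup>2)" if "y \<in> {0..x}" for y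
    proof -
      have "p * y \<le> p * x" using that p by simp
      then have py: "p * y < 1" using sin_lt assms by linarith
      have "q * y \<le> p * y" using that assms by (simp add: mult_right_mono)
      then have qy: "q * y < 1" using py by linarith
      have "(p * y)\<^sup>2 < 1" "(q * y)\<^sup>2 < 1"
        using py qy that assms p by (auto simp: power_less_one_iff)
      then show ?thesis by (simp add: power_mult_distrib)
    qed
    show ?thesis
      by (intro continuous_intros) (use pos in fastforce)
  qed
  have deriv: "(?s has_real_derivative cos \<theta> / p) (at \<theta> within {0..\<phi>})" for \<theta>
    using p by (auto intro!: derivative_eq_intros)
  have img: "?s ` {0..\<phi>} \<subseteq> {0..x}"
  proof
    fix y assume "y \<in> ?s ` {0..\<phi>}"
    then obtain \<theta> where \<theta>: "0 \<le> \<theta>" "\<theta> \<le> \<phi>" "y = sin \<theta> / p" by auto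
    have "0 \<le> sin \<theta>" using \<theta> assms by (intro sin_ge_zero) auto
    moreover have "sin \<theta> \<le> sin \<phi>" using \<theta> assms by (intro sin_monotone_2pi_le) auto
    ultimately show "y \<in> {0..x}" using \<theta> x p by (auto simp: divide_right_mono)
  qed
  have "((\<lambda>\<theta>. (cos \<theta> / p) *\<^sub>R ?f (?s \<theta>)) has_integral (integral {?s 0..?s \<phi>} ?f)) {0..\<phi>}"
    by (rule has_integral_substitution[OF _ _ img cont deriv])
       (use assms x0 x in auto)
  then have "((\<lambda>\<theta>. (cos \<theta> / p) *\<^sub>R ?f (?s \<theta>)) has_integral elliptic_pq p q x) {0..\<phi>}"
    by (simp add: elliptic_pq_def x)
  moreover have "(cos \<theta> / p) *\<^sub>R ?f (?s \<theta>) = (1 / p) * (1 / sqrt (1 - (q/p)\<^sup>2 * (sin \<theta>)\<^sup>2))"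
    if "\<theta> \<in> {0..\<phi>}" for \<theta>
  proof -
    have c: "0 < cos \<theta>" using that assms by (intro cos_gt_zero_pi) auto
    have "1 - p\<^sup>2 * (?s \<theta>)\<^sup>2 = (cos \<theta>)\<^sup>2"
      using p by (simp add: power_divide cos_squared_eq)
    moreover have "1 - q\<^sup>2 * (?s \<theta>)\<^sup>2 = 1 - (q/p)\<^sup>2 * (sin \<theta>)\<^sup>2"
      by (simp add: power_divide)
    ultimately have "?f (?s \<theta>) = 1 / (cos \<theta> * sqrt (1 - (q/p)\<^sup>2 * (sin \<theta>)\<^sup>2))"
      using c by (simp only: real_sqrt_mult real_sqrt_abs abs_of_pos)
    then show ?thesis using c by simp
  qed
  ultimately have "((\<lambda>\<theta>. (1 / p) * (1 / sqrt (1 - (q/p)\<^sup>2 * (sin \<theta>)\<^sup>2)))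
      has_integral elliptic_pq p q x) {0..\<phi>}"
    by (rule has_integral_eq[rotated])
  then have "elliptic_pq p q x = integral {0..\<phi>} (\<lambda>\<theta>. (1 / p) * (1 / sqrt (1 - (q/p)\<^sup>2 * (sin \<theta>)\<^sup>2)))"
    by (simp only: integral_unique)
  then show ?thesis
    unfolding elliptic_F_def by (simp only: integral_mult_right) simp
qed

section \<open>The two means and the new modulus\<close>

lemma gmean_squared: "0 \<le> p * q \<Longrightarrow> (gmean p q)\<^sup>2 = p * q"
  by (simp add: gmean_def)

text \<open>The squares differ by ((p - q)/2)^2. The inequality makes the Legendre form available
  for the pair of means.\<close>

lemma gmean_less_amean:
  assumes "0 < q" "q < p"
  shows "gmean p q < amean p q"
proof (rule power2_less_imp_less)
  have "(amean p q)\<^sup>2 = p * q + ((p - q) / 2)\<^sup>2"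
    by (simp add: amean_def power2_eq_square field_simps)
  then show "(gmean p q)\<^sup>2 < (amean p q)\<^sup>2"
    using assms by (simp add: gmean_squared)
qed (use assms in \<open>simp add: amean_def\<close>)

text \<open>This is the ascending Landen map on moduli: pulling p out of sqrt (p q) and out of p + q
  leaves an expression in q/p alone.\<close>

lemma gmean_div_amean:
  assumes "0 < q" "0 < p"
  shows "gmean p q / amean p q = 2 * sqrt (q / p) / (1 + q / p)"
proof -
  have "p * q = p\<^sup>2 * (q / p)"
    using assms by (simp add: power2_eq_square)
  then have "sqrt (p * q) = p * sqrt (q / p)"
    using assms by (simp only: real_sqrt_mult real_sqrt_abs abs_of_pos)
  then show ?thesis
    using assms by (simp add: gmean_def amean_def field_simps)
qed

section \<open>Lagrange's substitution and its derivative\<close>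

context
  fixes p q :: real
  assumes q_pos: "0 < q" and q_less_p: "q < p"
begin

lemma p_pos: "0 < p"
  using q_pos q_less_p by simp

lemma amean_pos: "0 < amean p q"
  using q_pos p_pos by (simp add: amean_def)

lemma amean_less: "amean p q < p"
  using q_less_p by (simp add: amean_def)

text \<open>Since q < a < p for a = \<open>amean p q\<close>, the coefficients a^2, pq and aq are
  all at most ap. The single bound apt < 1 can therefore serve as the domain condition for the
  substitution.\<close>

lemma lagrange_factors_pos:
  assumes "0 \<le> t" "amean p q * p * t < 1"
  shows "0 < 1 - (amean p q)\<^sup>2 * t" "0 < 1 - p * q * t" "0 < 1 - amean p q * q * t"
proof -
  have "(amean p q)\<^sup>2 * t \<le> amean p q * p * t"
    using assms amean_pos amean_less by (auto simp: power2_eq_square intro!: mult_right_mono)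
  moreover have "q * (p * t) \<le> amean p q * (p * t)"
    using assms q_less_p p_pos by (intro mult_right_mono) (auto simp: amean_def)
  then have "p * q * t \<le> amean p q * p * t" by (simp add: mult_ac)
  moreover have "amean p q * q * t \<le> amean p q * p * t"
    using assms amean_pos q_less_p by (auto intro!: mult_right_mono)
  ultimately show "0 < 1 - (amean p q)\<^sup>2 * t" "0 < 1 - p * q * t" "0 < 1 - amean p q * q * t"
    using assms by linarith+
qed

lemma lagrange_subst_squared:
  assumes "amean p q * p * y\<^sup>2 < 1"
  shows "(lagrange_subst p q y)\<^sup>2 = y\<^sup>2 * (1 - (amean p q)\<^sup>2 * y\<^sup>2) / (1 - p * q * y\<^sup>2)"
  using lagrange_factors_pos[OF _ assms] q_pos p_pos
  by (simp add: lagrange_subst_def power_mult_distrib gmean_squared)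

lemma one_minus_lagrange_subst:
  assumes "amean p q * p * y\<^sup>2 < 1"
  shows "1 - p\<^sup>2 * (lagrange_subst p q y)\<^sup>2 = (1 - amean p q * p * y\<^sup>2)\<^sup>2 / (1 - p * q * y\<^sup>2)"
    and "1 - q\<^sup>2 * (lagrange_subst p q y)\<^sup>2 = (1 - amean p q * q * y\<^sup>2)\<^sup>2 / (1 - p * q * y\<^sup>2)"
  using lagrange_factors_pos[OF _ assms]
  by (simp_all add: lagrange_subst_squared[OF assms] divide_simps)
     (simp_all add: amean_def power2_eq_square field_simps)

lemma sqrt_lagrange_subst:
  assumes "amean p q * p * y\<^sup>2 < 1"
  shows "sqrt ((1 - p\<^sup>2 * (lagrange_subst p q y)\<^sup>2) * (1 - q\<^sup>2 * (lagrange_subst p q y)\<^sup>2))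
       = (1 - amean p q * p * y\<^sup>2) * (1 - amean p q * q * y\<^sup>2) / (1 - p * q * y\<^sup>2)"
proof (rule real_sqrt_unique)
  show "((1 - amean p q * p * y\<^sup>2) * (1 - amean p q * q * y\<^sup>2) / (1 - p * q * y\<^sup>2))\<^sup>2
      = (1 - p\<^sup>2 * (lagrange_subst p q y)\<^sup>2) * (1 - q\<^sup>2 * (lagrange_subst p q y)\<^sup>2)"
    unfolding one_minus_lagrange_subst[OF assms]
    by (simp only: power_divide power_mult_distrib times_divide_times_eq flip: power2_eq_square)
next
  show "0 \<le> (1 - amean p q * p * y\<^sup>2) * (1 - amean p q * q * y\<^sup>2) / (1 - p * q * y\<^sup>2)"
    using lagrange_factors_pos[OF _ assms] assms by simp
qed

text \<open>\<open>N\<close> is the value of the old root at the substituted point, and the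
  denominator is the root for the means. In this form the change of variables reduces to cancelling
  \<open>N\<close>.\<close>

lemma has_real_derivative_lagrange_subst:
  assumes "amean p q * p * y\<^sup>2 < 1"
  defines "N \<equiv> (1 - amean p q * p * y\<^sup>2) * (1 - amean p q * q * y\<^sup>2) / (1 - p * q * y\<^sup>2)"
  shows "(lagrange_subst p q has_real_derivative
           N / sqrt ((1 - (amean p q)\<^sup>2 * y\<^sup>2) * (1 - (gmean p q)\<^sup>2 * y\<^sup>2))) (at y within S)"
proof -
  define a where "a = amean p q"
  define A B where "A = 1 - a\<^sup>2 * y\<^sup>2" and "B = 1 - p * q * y\<^sup>2"
  have pos: "0 < A" "0 < B"
    using lagrange_factors_pos[OF _ assms(1)] by (simp_all add: A_def B_def a_def)
  have B_neq: "1 - p * q * y\<^sup>2 \<noteq> 0" using pos by (simp add: B_def)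
  have g: "(gmean p q)\<^sup>2 = p * q" using q_pos p_pos by (simp add: gmean_squared)
  define R where "R = sqrt (A / B)"
  have R: "0 < R" "R\<^sup>2 = A / B" using pos by (simp_all add: R_def)
  define D where "D = (- (2 * a\<^sup>2 * y) * B + A * (2 * p * q * y)) / B\<^sup>2"
  have "((\<lambda>y. (1 - a\<^sup>2 * y\<^sup>2) / (1 - p * q * y\<^sup>2)) has_real_derivative D) (at y within S)"
    unfolding D_def using B_neq
    by (auto intro!: derivative_eq_intros simp: A_def B_def power2_eq_square)
  moreover have "0 < (1 - a\<^sup>2 * y\<^sup>2) / (1 - p * q * y\<^sup>2)"
    using pos by (simp add: A_def B_def)
  ultimately have "((\<lambda>y. y * sqrt ((1 - a\<^sup>2 * y\<^sup>2) / (1 - p * q * y\<^sup>2))) has_real_derivative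
      1 * R + inverse R / 2 * D * y) (at y within S)"
    unfolding R_def A_def B_def
    by (intro DERIV_mult DERIV_ident DERIV_chain2[OF DERIV_real_sqrt])
  moreover have "1 * R + inverse R / 2 * D * y = N / sqrt (A * B)"
  proof -
    \<comment> \<open>This gives sqrt (A B) = B R, so that R becomes the common denominator of both
      sides.\<close>
    have "A * B = B\<^sup>2 * (A / B)"
      using pos by (simp add: power2_eq_square)
    then have "sqrt (A * B) = B * R"
      using pos unfolding R_def by (simp only: real_sqrt_mult real_sqrt_abs abs_of_pos)
    moreover have "1 * R + inverse R / 2 * D * y = (R\<^sup>2 + y * D / 2) / R"
      using R(1) by (simp add: field_simps power2_eq_square)
    moreover have "R\<^sup>2 + y * D / 2 = N / B"
    proof -
      \<comment> \<open>Both sides are 1 - 2 a^2 y^2 + a^2 p q y^4; the factorisation rests on p + q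
        = 2a.\<close>
      have "A * B + y * (- (a\<^sup>2 * y) * B + A * (p * q * y)) = (1 - a * p * y\<^sup>2) * (1 - a * q * y\<^sup>2)"
        by (simp add: A_def B_def a_def amean_def power2_eq_square field_simps)
      moreover have "R\<^sup>2 + y * D / 2 = (A * B + y * (- (a\<^sup>2 * y) * B + A * (p * q * y))) / B\<^sup>2"
        using pos unfolding R D_def by (simp add: field_simps power2_eq_square)
      ultimately show ?thesis by (simp add: N_def a_def B_def power2_eq_square)
    qed
    ultimately show ?thesis by simp
  qed
  ultimately show ?thesis
    unfolding lagrange_subst_def A_def B_def g a_def by simp
qed

section \<open>The new upper limit\<close>

context
  fixes x :: real
  assumes x_pos: "0 < x" and px_less: "p * x < 1"
begin

lemma square_px_less: "(p * x)\<^sup>2 < 1"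
  using px_less x_pos p_pos by (auto simp: power_less_one_iff)

lemma square_qx_less: "(q * x)\<^sup>2 < 1"
proof -
  have "(q * x)\<^sup>2 \<le> (p * x)\<^sup>2"
    using x_pos q_pos q_less_p by (intro power_mono mult_right_mono) auto
  then show ?thesis using square_px_less by simp
qed

lemma lagrange_radicand_pos: "0 < (1 - p\<^sup>2 * x\<^sup>2) * (1 - q\<^sup>2 * x\<^sup>2)"
  using square_px_less square_qx_less by (simp add: power_mult_distrib)

text \<open>The difference of squares shows that the inner root stays below 1 + pqx^2, and later
  yields the quadratic equation for the squared limit.\<close>

lemma lagrange_radicand_eq:
  "(1 + p * q * x\<^sup>2)\<^sup>2 - ((p + q) * x)\<^sup>2 = (1 - p\<^sup>2 * x\<^sup>2) * (1 - q\<^sup>2 * x\<^sup>2)"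
  by (simp add: power2_eq_square algebra_simps)

lemma lagrange_outer_radicand_pos:
  "0 < 1 + p * q * x\<^sup>2 - sqrt ((1 - p\<^sup>2 * x\<^sup>2) * (1 - q\<^sup>2 * x\<^sup>2))"
proof -
  have "0 < ((p + q) * x)\<^sup>2" using x_pos q_pos p_pos by simp
  then have "(1 - p\<^sup>2 * x\<^sup>2) * (1 - q\<^sup>2 * x\<^sup>2) < (1 + p * q * x\<^sup>2)\<^sup>2"
    using lagrange_radicand_eq by linarith
  then have "sqrt ((1 - p\<^sup>2 * x\<^sup>2) * (1 - q\<^sup>2 * x\<^sup>2)) < 1 + p * q * x\<^sup>2"
    using q_pos p_pos by (intro real_less_lsqrt) auto
  then show ?thesis by simp
qed

lemma amean_lagrange_limit:
  "amean p q * lagrange_limit x p q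
     = sqrt ((1 + p * q * x\<^sup>2 - sqrt ((1 - p\<^sup>2 * x\<^sup>2) * (1 - q\<^sup>2 * x\<^sup>2))) / 2)"
proof -
  have "amean p q * (sqrt 2 / (p + q)) = 1 / sqrt 2"
    using q_pos p_pos by (simp add: amean_def field_simps)
  then show ?thesis
    unfolding lagrange_limit_def real_sqrt_divide mult.assoc[symmetric] by simp
qed

lemma lagrange_limit_pos: "0 < lagrange_limit x p q"
  unfolding lagrange_limit_def using lagrange_outer_radicand_pos q_pos p_pos by simp

lemma lagrange_limit_squared:
  "2 * (amean p q)\<^sup>2 * (lagrange_limit x p q)\<^sup>2
     = 1 + p * q * x\<^sup>2 - sqrt ((1 - p\<^sup>2 * x\<^sup>2) * (1 - q\<^sup>2 * x\<^sup>2))"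
proof -
  have "(amean p q * lagrange_limit x p q)\<^sup>2
      = (1 + p * q * x\<^sup>2 - sqrt ((1 - p\<^sup>2 * x\<^sup>2) * (1 - q\<^sup>2 * x\<^sup>2))) / 2"
    unfolding amean_lagrange_limit using lagrange_outer_radicand_pos by simp
  then show ?thesis by (simp add: power_mult_distrib)
qed

text \<open>With s the new limit, dropping the positive inner root gives 2 a^2 s^2 < 1 + pqx^2,
  while (px)^2 < 1 gives p(1 + pqx^2) < p + q = 2a. Dividing by 2a leaves the claim, which keeps s
  short of the zero of the derivative.\<close>

lemma lagrange_limit_bound: "amean p q * p * (lagrange_limit x p q)\<^sup>2 < 1"
proof -
  have "q * (p * x)\<^sup>2 < q * 1"
    using square_px_less q_pos by (intro mult_strict_left_mono) auto
  then have "p * (p * q * x\<^sup>2) < q" by (simp add: power2_eq_square algebra_simps)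
  then have "p * (1 + p * q * x\<^sup>2) < p + q" by (simp add: algebra_simps)
  moreover have "p * (2 * (amean p q)\<^sup>2 * (lagrange_limit x p q)\<^sup>2) < p * (1 + p * q * x\<^sup>2)"
    unfolding lagrange_limit_squared using lagrange_radicand_pos p_pos by simp
  ultimately have "p * (2 * (amean p q)\<^sup>2 * (lagrange_limit x p q)\<^sup>2) < 2 * amean p q"
    by (simp add: amean_def)
  moreover have "p * (2 * (amean p q)\<^sup>2 * (lagrange_limit x p q)\<^sup>2)
      = 2 * amean p q * (amean p q * p * (lagrange_limit x p q)\<^sup>2)"
    by (simp add: power2_eq_square)
  ultimately show ?thesis using amean_pos by simp
qed

lemma lagrange_range_bound:
  assumes "y \<in> {0..lagrange_limit x p q}"
  shows "amean p q * p * y\<^sup>2 < 1"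
proof -
  have "y\<^sup>2 \<le> (lagrange_limit x p q)\<^sup>2" using assms by (auto intro!: power_mono)
  then have "amean p q * p * y\<^sup>2 \<le> amean p q * p * (lagrange_limit x p q)\<^sup>2"
    using amean_pos p_pos by (intro mult_left_mono) auto
  then show ?thesis using lagrange_limit_bound by simp
qed

lemma lagrange_subst_zero: "lagrange_subst p q 0 = 0"
  by (simp add: lagrange_subst_def)

text \<open>The square of the new limit is a root of \<open>a\<^sup>2t\<^sup>2 - (1 + pqx\<^sup>2)t + x\<^sup>2 = 0\<close>, which is
  the equation \<open>y\<^sup>2 = x\<^sup>2\<close> cleared of denominators.\<close>

lemma lagrange_subst_limit: "lagrange_subst p q (lagrange_limit x p q) = x"
proof -
  define t where "t = (lagrange_limit x p q)\<^sup>2"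
  define a where "a = amean p q"
  have b: "amean p q * p * t < 1" using lagrange_limit_bound by (simp add: t_def)
  have t0: "0 \<le> t" by (simp add: t_def)
  have a: "0 < a" "p + q = 2 * a" using amean_pos by (simp_all add: a_def amean_def)
  have "sqrt ((1 - p\<^sup>2 * x\<^sup>2) * (1 - q\<^sup>2 * x\<^sup>2)) = 1 + p * q * x\<^sup>2 - 2 * a\<^sup>2 * t"
    using lagrange_limit_squared by (simp add: t_def a_def)
  then have "(1 + p * q * x\<^sup>2 - 2 * a\<^sup>2 * t)\<^sup>2 = (1 - p\<^sup>2 * x\<^sup>2) * (1 - q\<^sup>2 * x\<^sup>2)"
    using lagrange_radicand_pos by (metis less_imp_le real_sqrt_pow2)
  also have "\<dots> = (1 + p * q * x\<^sup>2)\<^sup>2 - (2 * a * x)\<^sup>2"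
    using lagrange_radicand_eq a by simp
  finally have "4 * a\<^sup>2 * (t * (1 - a\<^sup>2 * t)) = 4 * a\<^sup>2 * (x\<^sup>2 * (1 - p * q * t))"
    by (simp add: power2_eq_square algebra_simps)
  then have "t * (1 - a\<^sup>2 * t) = x\<^sup>2 * (1 - p * q * t)"
    using a by simp
  then have "(lagrange_subst p q (lagrange_limit x p q))\<^sup>2 = x\<^sup>2"
    using lagrange_factors_pos(2)[OF t0 b]
    unfolding lagrange_subst_squared[OF lagrange_limit_bound] t_def[symmetric] a_def[symmetric] by simp
  moreover have "0 \<le> lagrange_subst p q (lagrange_limit x p q)"
    unfolding lagrange_subst_def
    using lagrange_limit_pos lagrange_factors_pos[OF t0 b] q_pos p_pos
    by (simp add: gmean_squared t_def)
  ultimately show ?thesis using x_pos by (simp add: power2_eq_iff_nonneg)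
qed

section \<open>Bijectivity and the change of variables\<close>

lemma strict_mono_on_lagrange_subst:
  "strict_mono_on {0..lagrange_limit x p q} (lagrange_subst p q)"
proof (rule strict_mono_onI)
  fix r s assume rs: "r \<in> {0..lagrange_limit x p q}" "s \<in> {0..lagrange_limit x p q}" "r < s"
  show "lagrange_subst p q r < lagrange_subst p q s"
  proof (rule DERIV_pos_imp_increasing[OF rs(3)])
    fix y assume "r \<le> y" "y \<le> s"
    then have b: "amean p q * p * y\<^sup>2 < 1" using rs by (intro lagrange_range_bound) auto
    show "\<exists>d. (lagrange_subst p q has_real_derivative d) (at y) \<and> 0 < d"
      using has_real_derivative_lagrange_subst[OF b, of UNIV]
        lagrange_factors_pos[OF zero_le_power2 b] b q_pos p_pos
      by (intro exI conjI) (assumption, simp add: gmean_squared)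
  qed
qed

lemma continuous_on_lagrange_subst:
  "continuous_on {0..lagrange_limit x p q} (lagrange_subst p q)"
  by (rule DERIV_continuous_on[OF has_real_derivative_lagrange_subst[OF lagrange_range_bound]])

text \<open>Monotonicity with the end values 0 and x confines the image, the intermediate value
  theorem fills it, and strictness gives injectivity.\<close>

lemma bij_betw_lagrange_subst:
  "bij_betw (lagrange_subst p q) {0..lagrange_limit x p q} {0..x}"
proof -
  let ?L = "lagrange_subst p q" and ?s = "lagrange_limit x p q"
  have mono: "?L r \<le> ?L s" if "r \<in> {0..?s}" "s \<in> {0..?s}" "r \<le> s" for r s
    using strict_mono_onD[OF strict_mono_on_lagrange_subst that(1,2)] that(3)
    by (cases "r = s") auto
  have "?L ` {0..?s} = {0..x}"
  proof
    show "?L ` {0..?s} \<subseteq> {0..x}"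
      using mono[of 0] mono[of _ ?s] lagrange_limit_pos
      by (auto simp: lagrange_subst_zero lagrange_subst_limit)
    show "{0..x} \<subseteq> ?L ` {0..?s}"
    proof
      fix y assume "y \<in> {0..x}"
      then have "\<exists>r. 0 \<le> r \<and> r \<le> ?s \<and> ?L r = y"
        using lagrange_limit_pos continuous_on_lagrange_subst
        by (intro IVT') (auto simp: lagrange_subst_zero lagrange_subst_limit)
      then show "y \<in> ?L ` {0..?s}" by auto
    qed
  qed
  then show ?thesis
    by (simp add: bij_betw_def strict_mono_on_imp_inj_on[OF strict_mono_on_lagrange_subst])
qed

text \<open>The old integrand becomes 1/N and the derivative is N/Q, so their product 1/Q is the
  integrand for the means.\<close>

lemma elliptic_pq_lagrange:
  "elliptic_pq p q x = elliptic_pq (amean p q) (gmean p q) (lagrange_limit x p q)"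
proof -
  let ?f = "\<lambda>y. 1 / sqrt ((1 - p\<^sup>2 * y\<^sup>2) * (1 - q\<^sup>2 * y\<^sup>2))"
  let ?L = "lagrange_subst p q" and ?s = "lagrange_limit x p q"
  let ?N = "\<lambda>y. (1 - amean p q * p * y\<^sup>2) * (1 - amean p q * q * y\<^sup>2) / (1 - p * q * y\<^sup>2)"
  let ?Q = "\<lambda>y. sqrt ((1 - (amean p q)\<^sup>2 * y\<^sup>2) * (1 - (gmean p q)\<^sup>2 * y\<^sup>2))"
  have img: "?L ` {0..?s} = {0..x}"
    using bij_betw_lagrange_subst by (simp add: bij_betw_def)
  have N: "0 < ?N y" if "y \<in> {0..?s}" for y
    using lagrange_factors_pos[OF _ lagrange_range_bound[OF that]] lagrange_range_bound[OF that] by simp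
  have fL: "?f (?L y) = 1 / ?N y" if "y \<in> {0..?s}" for y
    by (simp only: sqrt_lagrange_subst[OF lagrange_range_bound[OF that]])
  \<comment> \<open>Each point of \<open>{0..x}\<close> is the image of some r in the new range,
    where the old root equals the positive value N(r).\<close>
  have cont: "continuous_on {0..x} ?f"
  proof (intro continuous_intros ballI)
    fix y assume "y \<in> {0..x}"
    then obtain r where "r \<in> {0..?s}" "y = ?L r" using img by (metis imageE)
    then show "sqrt ((1 - p\<^sup>2 * y\<^sup>2) * (1 - q\<^sup>2 * y\<^sup>2)) \<noteq> 0"
      using sqrt_lagrange_subst[OF lagrange_range_bound] N by (metis less_irrefl)
  qed
  have "((\<lambda>y. (?N y / ?Q y) *\<^sub>R ?f (?L y)) has_integral (integral {?L 0..?L ?s} ?f)) {0..?s}"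
    by (rule has_integral_substitution[OF _ _ _ cont
          has_real_derivative_lagrange_subst[OF lagrange_range_bound]])
       (use img lagrange_limit_pos x_pos in \<open>auto simp: lagrange_subst_zero lagrange_subst_limit\<close>)
  then have "((\<lambda>y. (?N y / ?Q y) *\<^sub>R ?f (?L y)) has_integral elliptic_pq p q x) {0..?s}"
    by (simp add: elliptic_pq_def lagrange_subst_zero lagrange_subst_limit)
  moreover have "(?N y / ?Q y) *\<^sub>R ?f (?L y) = 1 / ?Q y" if "y \<in> {0..?s}" for y
  proof -
    \<comment> \<open>For d = 0 both sides are 0, so only the sign of \<open>n\<close>
      enters.\<close>
    have "(n / d) *\<^sub>R (1 / n) = 1 / d" if "0 < n" for n d :: real
      using that by simp
    then show ?thesis using N[OF that] unfolding fL[OF that] .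
  qed
  ultimately have "((\<lambda>y. 1 / ?Q y) has_integral elliptic_pq p q x) {0..?s}"
    by (rule has_integral_eq[rotated])
  then show ?thesis
    unfolding elliptic_pq_def[of "amean p q"] by (simp only: integral_unique)
qed

section \<open>Old and new amplitudes\<close>

lemma sin_arcsin_qx: "sin (arcsin (q * x)) = q * x"
  and arcsin_qx_bounds: "0 < arcsin (q * x)" "arcsin (q * x) < pi / 2"
proof -
  have qx: "0 < q * x" "q * x < 1"
    using q_pos x_pos square_qx_less by (auto simp: power_less_one_iff)
  then show "sin (arcsin (q * x)) = q * x" by simp
  show "0 < arcsin (q * x)" "arcsin (q * x) < pi / 2"
    using qx arcsin_less_arcsin[of 0 "q * x"] arcsin_less_arcsin[of "q * x" 1] by auto
qed

text \<open>With sin beta = qx, the inner root is cos phi cos beta and pqx^2 is sin phi sin beta, so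
  the outer radicand is 1 - cos (phi + beta). The half-angle formula then applies, with positive
  sign because the half sum lies in (0, pi/2).\<close>

lemma amean_lagrange_limit_eq_sin:
  assumes "0 < \<phi>" "\<phi> < pi / 2" "sin \<phi> = p * x"
  shows "amean p q * lagrange_limit x p q = sin ((\<phi> + arcsin (q * x)) / 2)"
proof -
  define \<beta> where "\<beta> = arcsin (q * x)"
  note sb = sin_arcsin_qx[folded \<beta>_def] and \<beta> = arcsin_qx_bounds[folded \<beta>_def]
  have c: "0 < cos \<phi>" "0 < cos \<beta>" using assms \<beta> by (auto intro!: cos_gt_zero_pi)
  have "sqrt ((1 - p\<^sup>2 * x\<^sup>2) * (1 - q\<^sup>2 * x\<^sup>2)) = cos \<phi> * cos \<beta>"
    using c assms sb
    by (intro real_sqrt_unique) (auto simp: power_mult_distrib cos_squared_eq)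
  then have "1 + p * q * x\<^sup>2 - sqrt ((1 - p\<^sup>2 * x\<^sup>2) * (1 - q\<^sup>2 * x\<^sup>2)) = 1 - cos (\<phi> + \<beta>)"
    using assms sb by (simp add: cos_add power2_eq_square)
  also have "\<dots> = 2 * (sin ((\<phi> + \<beta>) / 2))\<^sup>2"
  proof -
    have "\<phi> + \<beta> = 2 * ((\<phi> + \<beta>) / 2)" by simp
    then have "cos (\<phi> + \<beta>) = 1 - 2 * (sin ((\<phi> + \<beta>) / 2))\<^sup>2"
      using cos_double_sin by metis
    then show ?thesis by simp
  qed
  finally have "amean p q * lagrange_limit x p q = \<bar>sin ((\<phi> + \<beta>) / 2)\<bar>"
    unfolding amean_lagrange_limit by simp
  moreover have "0 < sin ((\<phi> + \<beta>) / 2)" using assms \<beta> by (intro sin_gt_zero) auto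
  ultimately show ?thesis by (simp add: \<beta>_def)
qed

end

end

text \<open>The conjuncts on the substitution, the integrals and the modulus certify that the new
  amplitude really comes from Lagrange's transformation. It is fixed by the transformed limit, and
  its explicit square root is derived.\<close>

theorem theorem3p1:
  fixes p q x k \<phi> :: real
  assumes "0 < q" and "q < p"
    and "0 < x" and "x < 1 / p"
    and "k = q / p"
    and "0 < \<phi>" and "\<phi> < pi / 2" and "sin \<phi> = p * x"
  shows
    "bij_betw (lagrange_subst p q) {0..lagrange_limit x p q} {0..x} \<and>
     elliptic_pq p q x = elliptic_pq (amean p q) (gmean p q) (lagrange_limit x p q) \<and>
     elliptic_pq p q x = elliptic_F k \<phi> / p \<and>
     gmean p q / amean p q = 2 * sqrt k / (1 + k) \<and>
     (\<exists>!\<phi>h. \<phi>h \<in> {0<..<pi/2} \<and> sin \<phi>h = amean p q * lagrange_limit x p q) \<and>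
     (\<forall>\<phi>h \<in> {0<..<pi/2}. sin \<phi>h = amean p q * lagrange_limit x p q \<longrightarrow>
        elliptic_pq (amean p q) (gmean p q) (lagrange_limit x p q)
          = elliptic_F (gmean p q / amean p q) \<phi>h / amean p q \<and>
        sin \<phi>h = sqrt ((1 + p * q * x\<^sup>2 - sqrt ((1 - p\<^sup>2 * x\<^sup>2) * (1 - q\<^sup>2 * x\<^sup>2))) / 2) \<and>
        tan \<phi> = sin (2 * \<phi>h) / (k + cos (2 * \<phi>h)))"
proof (intro conjI ballI impI)
  have p: "0 < p" using assms by simp
  have px: "p * x < 1" using assms p by (simp add: field_simps)
  note hyps = assms(1,2,3) px
  let ?a = "amean p q" and ?g = "gmean p q" and ?s = "lagrange_limit x p q"
  show "bij_betw (lagrange_subst p q) {0..?s} {0..x}"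
    by (rule bij_betw_lagrange_subst[OF hyps])
  show "elliptic_pq p q x = elliptic_pq ?a ?g ?s"
    by (rule elliptic_pq_lagrange[OF hyps])
  show "elliptic_pq p q x = elliptic_F k \<phi> / p"
    using elliptic_pq_eq_elliptic_F[of q p \<phi> x] assms by simp
  show "?g / ?a = 2 * sqrt k / (1 + k)"
    using gmean_div_amean[of q p] assms p by simp
  define \<beta> where "\<beta> = arcsin (q * x)"
  note sb = sin_arcsin_qx[OF hyps, folded \<beta>_def]
    and \<beta> = arcsin_qx_bounds[OF hyps, folded \<beta>_def]
  have sin_half: "?a * ?s = sin ((\<phi> + \<beta>) / 2)"
    unfolding \<beta>_def by (rule amean_lagrange_limit_eq_sin[OF hyps assms(6-8)])
  \<comment> \<open>The sine is injective on (0, pi/2), so any admissible amplitude is the half sum;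
    this gives both uniqueness and the doubled angle used below.\<close>
  have unique: "\<psi> = (\<phi> + \<beta>) / 2" if "\<psi> \<in> {0<..<pi/2}" "sin \<psi> = ?a * ?s" for \<psi>
    using that \<beta> assms(6,7) unfolding sin_half by - (rule sin_inj_pi, auto)
  show "\<exists>!\<phi>h. \<phi>h \<in> {0<..<pi/2} \<and> sin \<phi>h = ?a * ?s"
    using unique sin_half \<beta> assms(6,7) by (intro ex1I[of _ "(\<phi> + \<beta>) / 2"]) auto
  fix \<psi> assume \<psi>: "\<psi> \<in> {0<..<pi/2}" "sin \<psi> = ?a * ?s"
  show "elliptic_pq ?a ?g ?s = elliptic_F (?g / ?a) \<psi> / ?a"
    using \<psi> assms p gmean_less_amean[of q p]
    by (intro elliptic_pq_eq_elliptic_F) (auto simp: gmean_def)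
  show "sin \<psi> = sqrt ((1 + p * q * x\<^sup>2 - sqrt ((1 - p\<^sup>2 * x\<^sup>2) * (1 - q\<^sup>2 * x\<^sup>2))) / 2)"
    using \<psi>(2) amean_lagrange_limit[OF hyps] by simp
  have double: "2 * \<psi> = \<phi> + \<beta>" using unique[OF \<psi>] by simp
  have s: "0 < sin \<phi>" using assms p by simp
  have c: "0 < cos \<phi>" using assms by (intro cos_gt_zero_pi) auto
  \<comment> \<open>This factor is cancelled in the final quotient.\<close>
  have sum_pos: "0 < sin (\<phi> + \<beta>)" using \<beta> assms(6,7) by (intro sin_gt_zero) auto
  have "k = sin \<beta> / sin \<phi>" using assms sb p by simp
  \<comment> \<open>Collecting the terms in sin beta produces 1 - sin^2 phi = cos^2 phi; a factor
    cos phi then splits off and leaves the addition formula for the sine.\<close>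
  then have "k + cos (\<phi> + \<beta>) = (sin \<beta> * (1 - (sin \<phi>)\<^sup>2) + sin \<phi> * cos \<phi> * cos \<beta>) / sin \<phi>"
    using s by (simp add: cos_add field_simps power2_eq_square)
  also have "\<dots> = cos \<phi> * sin (\<phi> + \<beta>) / sin \<phi>"
    unfolding cos_squared_eq[symmetric] by (simp add: sin_add power2_eq_square algebra_simps)
  finally show "tan \<phi> = sin (2 * \<psi>) / (k + cos (2 * \<psi>))"
    unfolding double using s c sum_pos by (simp add: tan_def)
qed

end
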